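(* Let $\xi$ be a Chern character of positive rank on $\mathbb{P}^2$ such that $M(\xi)$ has Picard rank $2$. The parabola $Q_\xi$ intersects the line $\Delta=\frac12$ at two points. If $\mu_0\in\mathbb{R}$ is the larger of the two slopes such that $(\mu_0,\frac12)\in Q_\xi$, then there is a unique exceptional slope $\alpha$ such that $\mu_0\in I_\alpha$.
   Context: For a Chern character $\xi=(r,\mathrm{ch}_1,\mathrm{ch}_2)$ on $\mathbb{P}^2$ with $r>0$ put $\mu(\xi)=\mathrm{ch}_1/r$ and $\Delta(\xi)=\frac12\mu(\xi)^2-\mathrm{ch}_2/r$; $\xi$ is also recorded as $(r,\mu,\Delta)$. Let $P(m)=\frac12(m^2+3m+2)$. $M(\xi)$ is the moduli space of Gieseker semistable sheaves of Chern character $\xi$ on $\mathbb{P}^2$ (over $\mathbb{C}$). $Q_\xi$ is the parabola $\Delta=P(\mu(\xi)+\mu)-\Delta(\xi)$ in the $(\mu,\Delta)$-plane, i.e. the set of $(\mu,\Delta)$ such that $(1,\mu,\Delta)$ is orthogonal to $\xi$ under the pairing $(\xi,\zeta)=\chi(\xi^*,\zeta)$. The set $\mathcal{E}\subset\mathbb{Q}$ of exceptional slopes (slopes of exceptional bundles on $\mathbb{P}^2$) is the image of the injective map $\varepsilon:\mathbb{Z}[\frac12]\to\mathbb{Q}$ defined inductively by $\varepsilon(n)=n$ for $n\in\mathbb{Z}$ and $\varepsilon\left(\frac{2p+1}{2^{q+1}}\right)=\varepsilon\left(\frac p{2^q}\right).\,\varepsilon\left(\frac{p+1}{2^q}\right)$,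 where $\alpha.\beta=\frac{\alpha+\beta}2+\frac{\Delta_\beta-\Delta_\alpha}{3+\alpha-\beta}$. Here $r_\alpha$ is the least positive integer with $r_\alpha\alpha\in\mathbb{Z}$ and $\Delta_\alpha=\frac12(1-r_\alpha^{-2})$. For $\alpha\in\mathcal{E}$, $x_\alpha=\frac{3-\sqrt{5+8\Delta_\alpha}}2$ and $I_\alpha=(\alpha-x_\alpha,\alpha+x_\alpha)$. Let $\delta(\mu)=\sup\{P(-|\mu-\alpha|)-\Delta_\alpha:\alpha\in\mathcal{E},|\mu-\alpha|<3\}$. For $\xi$ of positive integer rank, $M(\xi)$ (nonempty) has Picard rank $2$ if and only if $c_1=r\mu\in\mathbb{Z}$, $\chi=r(P(\mu)-\Delta)\in\mathbb{Z}$ and $\Delta>\delta(\mu)$ (theorems of Drézet and Le Potier). *)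

theory Defs
  imports Complex_Main
begin

section \<open>Chern characters on the projective plane\<close>

record chern_character =
  rk :: int
  ch1 :: real
  ch2 :: real

definition slope :: "chern_character \<Rightarrow> real" where
  "slope \<xi> = ch1 \<xi> / of_int (rk \<xi>)"

definition discr :: "chern_character \<Rightarrow> real" where
  "discr \<xi> = (slope \<xi>)\<^sup>2 / 2 - ch2 \<xi> / of_int (rk \<xi>)"

definition P :: "real \<Rightarrow> real" where
  "P m = (m\<^sup>2 + 3 * m + 2) / 2"

text \<open>The holomorphic Euler characteristic, by Riemann--Roch.\<close>

definition euler_char :: "chern_character \<Rightarrow> real" where
  "euler_char \<xi> = of_int (rk \<xi>) * (P (slope \<xi>) - discr \<xi>)"

text \<open>
  The points \<open>(\<mu>, \<Delta>)\<close> such that \<open>(1, \<mu>, \<Delta>)\<close> is orthogonal to \<open>\<xi>\<close> for the pairing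
  \<open>\<chi>(\<xi>\<^sup>*, \<zeta>) = r(\<xi>) r(\<zeta>) (P (\<mu>(\<xi>) + \<mu>(\<zeta>)) - \<Delta>(\<xi>) - \<Delta>(\<zeta>))\<close>.
\<close>

definition orth_parabola :: "chern_character \<Rightarrow> (real \<times> real) set" where
  "orth_parabola \<xi> = {(\<mu>, \<Delta>). \<Delta> = P (slope \<xi> + \<mu>) - discr \<xi>}"

section \<open>Exceptional slopes\<close>

definition exc_rank :: "rat \<Rightarrow> nat" where
  "exc_rank \<alpha> = (LEAST r. r > 0 \<and> of_nat r * \<alpha> \<in> \<int>)"

definition exc_discr :: "rat \<Rightarrow> rat" where
  "exc_discr \<alpha> = (1 - 1 / (of_nat (exc_rank \<alpha>))\<^sup>2) / 2"

definition exc_dot :: "rat \<Rightarrow> rat \<Rightarrow> rat" where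
  "exc_dot \<alpha> \<beta> = (\<alpha> + \<beta>) / 2 + (exc_discr \<beta> - exc_discr \<alpha>) / (3 + \<alpha> - \<beta>)"

text \<open>
  \<open>eps p q\<close> is the value of \<open>\<epsilon>\<close> at the dyadic rational \<open>p / 2\<^sup>q\<close>. The fraction need not be
  reduced: the even case cancels a factor of two, so the value depends only on \<open>p / 2\<^sup>q\<close>.
\<close>

fun eps :: "int \<Rightarrow> nat \<Rightarrow> rat" where
  "eps p 0 = of_int p"
| "eps p (Suc q) =
    (if even p then eps (p div 2) q
     else exc_dot (eps (p div 2) q) (eps (p div 2 + 1) q))"

definition exceptional_slopes :: "rat set" where
  "exceptional_slopes = {eps p q | p q. True}"

definition exc_radius :: "rat \<Rightarrow> real" where
  "exc_radius \<alpha> = (3 - sqrt (5 + 8 * of_rat (exc_discr \<alpha>))) / 2"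

definition exc_interval :: "rat \<Rightarrow> real set" where
  "exc_interval \<alpha> = {of_rat \<alpha> - exc_radius \<alpha> <..< of_rat \<alpha> + exc_radius \<alpha>}"

section \<open>Moduli spaces of Picard rank two\<close>

definition DLP :: "real \<Rightarrow> real" where
  "DLP \<mu> = Sup {P (- \<bar>\<mu> - of_rat \<alpha>\<bar>) - of_rat (exc_discr \<alpha>) | \<alpha>.
                  \<alpha> \<in> exceptional_slopes \<and> \<bar>\<mu> - of_rat \<alpha>\<bar> < 3}"

text \<open>
  By theorems of Drezet and Le Potier this is, for \<open>\<xi>\<close> of positive rank, the condition that
  the moduli space \<open>M(\<xi>)\<close> of Gieseker semistable sheaves on the complex projective plane is
  nonempty and has Picard rank two. It stands in for that statement, since neither \<open>M(\<xi>)\<close> nor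
  its Picard group is constructed here.
\<close>

definition picard_rank_two :: "chern_character \<Rightarrow> bool" where
  "picard_rank_two \<xi> \<longleftrightarrow>
     ch1 \<xi> \<in> \<int> \<and> euler_char \<xi> \<in> \<int> \<and> discr \<xi> > DLP (slope \<xi>)"

end

theory Submission imports Defs begin

text \<open>
  If a real \<open>x\<close> lies in no interval \<open>I\<^sub>\<alpha>\<close>, then following \<open>x\<close> down the dyadic tree of exceptional
  slopes yields exceptional slopes \<open>\<alpha>\<close> of arbitrarily large rank with \<open>r\<^sub>\<alpha> \<bar>x - \<alpha>\<bar>\<close> arbitrarily
  small. A rational \<open>x\<close> cannot be approximated so well, hence every rational slope lies in some
  \<open>I\<^sub>\<alpha>\<close>; this gives \<open>\<delta>(\<mu>(\<xi>)) > 1/2\<close> and so \<open>\<Delta>(\<xi>) > 1/2\<close>.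
  For \<open>x = \<mu>\<^sub>0\<close>, the integer \<open>\<chi>(\<xi> \<otimes> E\<^sub>\<alpha>)\<close> becomes smaller than \<open>1\<close> in absolute value, hence
  vanishes, which says that \<open>d = \<mu>\<^sub>0 - \<alpha>\<close> satisfies \<open>d (w - d) = 1 / r\<^sub>\<alpha>\<^sup>2\<close> with \<open>w\<^sup>2 = 5 + 8 \<Delta>(\<xi>) > 9\<close>.
  Since \<open>x\<^sub>\<alpha> (3 - x\<^sub>\<alpha>) = 1 / r\<^sub>\<alpha>\<^sup>2\<close>, this forces \<open>0 < d < x\<^sub>\<alpha>\<close>, a contradiction.
  Uniqueness holds because the intervals are disjoint: for neighbouring slopes at distance \<open>t\<close>
  the Markov type equation \<open>t (3 - t) = x\<^sub>\<alpha> (3 - x\<^sub>\<alpha>) + x\<^sub>\<beta> (3 - x\<^sub>\<beta>)\<close> gives \<open>t \<ge> x\<^sub>\<alpha> + x\<^sub>\<beta>\<close>.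
\<close>

section \<open>Neighbouring exceptional slopes\<close>

text \<open>
  \<open>adj a r b s\<close>: the reduced fractions \<open>a/r < b/s\<close> are the values of \<open>\<epsilon>\<close> at consecutive
  \<open>p/2\<^sup>q\<close> and \<open>(p+1)/2\<^sup>q\<close>. The slope between them is \<open>c/m\<close>; the two equations for \<open>c\<close> are equivalent,
  by the Markov equation \<open>r\<^sup>2 + s\<^sup>2 + m\<^sup>2 = 3 r s m\<close>, and are interchanged by negating slopes.
\<close>

inductive adj :: "int \<Rightarrow> int \<Rightarrow> int \<Rightarrow> int \<Rightarrow> bool" where
  base: "adj n 1 (n + 1) 1"
| left: "adj a r b s \<Longrightarrow> m = 3 * r * s - (r * b - s * a) \<Longrightarrow> r * c = a * m + s \<Longrightarrow> adj a r c m"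
| right: "adj a r b s \<Longrightarrow> m = 3 * r * s - (r * b - s * a) \<Longrightarrow> s * c = b * m - r \<Longrightarrow> adj c m b s"

lemma adj_mirror: "adj a r b s \<Longrightarrow> adj (- b) s (- a) r"
proof (induction rule: adj.induct)
  case (base n)
  show ?case using adj.base[of "- n - 1"] by simp
next
  case (left a r b s m c)
  show ?case
    by (rule adj.right[OF left.IH]) (use left.hyps in \<open>simp_all add: algebra_simps\<close>)
next
  case (right a r b s m c)
  show ?case
    by (rule adj.left[OF right.IH]) (use right.hyps in \<open>simp_all add: algebra_simps\<close>)
qed

text \<open>With \<open>m = 3 * r * s - (r * b - s * a)\<close>, the rank of the slope in between,
  the last equation is the Markov equation. The bound by \<open>r * s\<close> keeps the gap at most
  1, hence \<open>m \<ge> 2 * r * s\<close>.\<close>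

definition adj_inv :: "int \<Rightarrow> int \<Rightarrow> int \<Rightarrow> int \<Rightarrow> bool" where
  "adj_inv a r b s \<longleftrightarrow> r > 0 \<and> s > 0 \<and> r dvd a\<^sup>2 + 1 \<and> s dvd b\<^sup>2 + 1 \<and> coprime r s \<and>
     r * b - s * a > 0 \<and> r * b - s * a \<le> r * s \<and>
     (r * b - s * a) * (3 * r * s - (r * b - s * a)) = r\<^sup>2 + s\<^sup>2"

lemma adj_inv_mirror: "adj_inv a r b s \<Longrightarrow> adj_inv (- b) s (- a) r"
  unfolding adj_inv_def by (simp add: algebra_simps coprime_commute)

lemma coprime_of_dvd_square_plus_one:
  fixes a r :: int
  assumes "r dvd a\<^sup>2 + 1"
  shows "coprime a r"
proof (rule coprimeI)
  fix d assume "d dvd a" "d dvd r"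
  then have "d dvd a\<^sup>2 + 1" "d dvd a\<^sup>2"
    using assms by (auto simp: power2_eq_square intro: dvd_trans)
  then show "is_unit d"
    using dvd_add_right_iff by blast
qed

text \<open>The Markov triple is unchanged; only the roles of its entries move. Since
  \<open>m\<close> is coprime to \<open>r\<close>, divisibility of \<open>c^2 + 1\<close> by
  \<open>m\<close> can be tested after multiplying by \<open>r^2\<close>, where
  \<open>r^2 + s^2\<close> splits off a factor \<open>m\<close>.\<close>

lemma adj_inv_left:
  assumes inv: "adj_inv a r b s" and m: "m = 3 * r * s - (r * b - s * a)" and c: "r * c = a * m + s"
  shows "adj_inv a r c m" "s * c = b * m - r" "m \<ge> 2 * r * s"
proof -
  have pos: "r > 0" "s > 0" and da: "r dvd a\<^sup>2 + 1" and db: "s dvd b\<^sup>2 + 1" and co: "coprime r s"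
    and D: "r * b - s * a > 0" "r * b - s * a \<le> r * s"
    and mk: "(r * b - s * a) * m = r\<^sup>2 + s\<^sup>2"
    using inv unfolding adj_inv_def m by auto
  show m2: "m \<ge> 2 * r * s" using D m by simp
  have mpos: "m > 0" using m2 pos by (smt (verit) mult_pos_pos)
  have "r * (s * c) = s * (a * m + s)" by (simp add: c[symmetric] mult.left_commute)
  also have "\<dots> = r * (b * m - r)"
    using mk by (simp add: algebra_simps power2_eq_square)
  finally show sc: "s * c = b * m - r" using pos by simp
  have "coprime r (s * a)"
    using co coprime_of_dvd_square_plus_one[OF da] by (simp add: coprime_commute)
  then have rm: "coprime r m"
  proof -
    have "m = (3 * s - b) * r + s * a" using m by (simp add: algebra_simps)
    then show ?thesis using \<open>coprime r (s * a)\<close>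
      by (metis add.commute coprime_iff_gcd_eq_1 gcd_add_mult mult.commute)
  qed
  have "r\<^sup>2 * (c\<^sup>2 + 1) = (a * m + s)\<^sup>2 + r\<^sup>2"
    using c by (metis distrib_left mult.right_neutral power_mult_distrib)
  also have "\<dots> = m * (a\<^sup>2 * m + 2 * a * s + (r * b - s * a))"
    using mk by (simp add: algebra_simps power2_eq_square)
  finally have "m dvd r\<^sup>2 * (c\<^sup>2 + 1)" by simp
  then have mc: "m dvd c\<^sup>2 + 1"
    using rm by (metis coprime_commute coprime_dvd_mult_right_iff coprime_power_right_iff)
  \<comment> \<open>The new gap has numerator \<open>s\<close>, the rank of the neighbour that is
    dropped.\<close>
  have D': "r * c - m * a = s" using c by (simp add: algebra_simps)
  have "1 \<le> r * r" using pos by (simp add: int_one_le_iff_zero_less)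
  then have "s * 1 \<le> s * (2 * (r * r))" using pos by (intro mult_left_mono) auto
  also have "\<dots> = r * (2 * r * s)" by simp
  also have "\<dots> \<le> r * m" using m2 pos by (intro mult_left_mono) auto
  finally have le: "s \<le> r * m" by simp
  have "s * (3 * r * m - s) = r\<^sup>2 + m\<^sup>2"
  proof -
    have "r * b - s * a = 3 * r * s - m" using m by simp
    then have "(3 * r * s - m) * m = r\<^sup>2 + s\<^sup>2" using mk by simp
    then show ?thesis by (simp add: algebra_simps power2_eq_square)
  qed
  then show "adj_inv a r c m"
    unfolding adj_inv_def D' using pos mpos da mc rm le by auto
qed

lemma adj_inv_right:
  assumes inv: "adj_inv a r b s" and m: "m = 3 * r * s - (r * b - s * a)" and c: "s * c = b * m - r"
  shows "adj_inv c m b s" "r * c = a * m + s" "m \<ge> 2 * r * s"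
proof -
  have *: "m = 3 * s * r - (s * - a - r * - b)" "s * (- c) = (- b) * m + r"
    using m c by (simp_all add: algebra_simps)
  note L = adj_inv_left[OF adj_inv_mirror[OF inv] *]
  show "adj_inv c m b s" using adj_inv_mirror[OF L(1)] by simp
  show "r * c = a * m + s" using L(2) by simp
  show "m \<ge> 2 * r * s" using L(3) by (simp add: algebra_simps)
qed

lemma adj_invariant: "adj a r b s \<Longrightarrow> adj_inv a r b s"
proof (induction rule: adj.induct)
  case (base n)
  show ?case by (simp add: adj_inv_def)
next
  case (left a r b s m c)
  then show ?case using adj_inv_left(1) by blast
next
  case (right a r b s m c)
  then show ?case using adj_inv_right(1) by blast
qed

lemma adj_mediant:
  assumes "adj a r b s"
  obtains m c where "m = 3 * r * s - (r * b - s * a)" "r * c = a * m + s" "s * c = b * m - r"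
    "m \<ge> 2 * r * s" "adj a r c m" "adj c m b s"
proof -
  define m where "m = 3 * r * s - (r * b - s * a)"
  have inv: "adj_inv a r b s" using assms by (rule adj_invariant)
  \<comment> \<open>Modulo \<open>r\<close> one has \<open>m = s * a\<close>, so
    \<open>a * m + s\<close> becomes \<open>s * (a^2 + 1)\<close>; this makes \<open>c\<close> an
    integer.\<close>
  have "a * m + s = r * (3 * a * s - a * b) + s * (a\<^sup>2 + 1)"
    unfolding m_def by (simp add: algebra_simps power2_eq_square)
  moreover have "r dvd a\<^sup>2 + 1" using inv by (simp add: adj_inv_def)
  ultimately have "r dvd a * m + s" by simp
  then obtain c where c: "r * c = a * m + s" by (metis dvdE)
  note L = adj_inv_left[OF inv m_def c]
  show ?thesis
    using that[OF m_def c L(2,3) adj.left[OF assms m_def c] adj.right[OF assms m_def L(2)]] .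
qed

section \<open>Adjacent fractions and the map epsilon\<close>

lemma exc_rank_fraction:
  assumes "r > 0" "coprime a r"
  shows "exc_rank (of_int a / of_int r) = nat r"
  unfolding exc_rank_def
proof (rule Least_equality)
  show "nat r > 0 \<and> of_nat (nat r) * (of_int a / of_int r :: rat) \<in> \<int>" using assms by simp
next
  fix n :: nat
  assume n: "n > 0 \<and> of_nat n * (of_int a / of_int r :: rat) \<in> \<int>"
  then obtain k where "of_nat n * (of_int a / of_int r :: rat) = of_int k" by (auto elim: Ints_cases)
  then have "of_int (int n * a) = (of_int (k * r) :: rat)" using assms by (simp add: field_simps)
  then have "int n * a = k * r" by (simp only: of_int_eq_iff)
  then have "r dvd int n * a" by simp
  then have "r dvd int n" using assms(2) by (simp add: coprime_commute coprime_dvd_mult_left_iff)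
  then show "nat r \<le> n" using n zdvd_imp_le by fastforce
qed

lemma exc_discr_fraction:
  assumes "r > 0" "r dvd a\<^sup>2 + 1"
  shows "exc_discr (of_int a / of_int r) = (1 - 1 / (of_int r)\<^sup>2) / 2"
  using exc_rank_fraction[OF assms(1) coprime_of_dvd_square_plus_one[OF assms(2)]] assms(1)
  by (simp add: exc_discr_def)

text \<open>The mean of \<open>a/r\<close> and \<open>b/s\<close> misses \<open>c/m\<close> by
  \<open>(r/s - s/r) / (2 * m)\<close>, and the discriminant term of \<open>exc_dot\<close> is
  exactly the opposite of this because \<open>3 + a/r - b/s = m / (r * s)\<close>.\<close>

lemma exc_dot_mediant:
  assumes inv: "adj_inv a r b s" and m: "m = 3 * r * s - (r * b - s * a)" and c: "r * c = a * m + s"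
  shows "exc_dot (of_int a / of_int r) (of_int b / of_int s) = of_int c / of_int m"
proof -
  have pos: "r > 0" "s > 0" and dv: "r dvd a\<^sup>2 + 1" "s dvd b\<^sup>2 + 1"
    and mk: "(r * b - s * a) * m = r\<^sup>2 + s\<^sup>2"
    using inv unfolding adj_inv_def m by auto
  have mpos: "m > 0" using adj_inv_left(3)[OF assms] pos by (smt (verit) mult_pos_pos)
  note sc = adj_inv_left(2)[OF assms]
  define a' r' b' s' m' c' :: rat where defs: "a' = of_int a" "r' = of_int r" "b' = of_int b"
    "s' = of_int s" "m' = of_int m" "c' = of_int c"
  have nz: "r' > 0" "s' > 0" "m' > 0" using pos mpos by (simp_all add: defs)
  have m': "m' = 3 * r' * s' - (r' * b' - s' * a')" unfolding defs m by simp
  have rc: "r' * c' = a' * m' + s'" unfolding defs by (metis c of_int_add of_int_mult)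
  have sc': "s' * c' = b' * m' - r'" unfolding defs by (metis sc of_int_diff of_int_mult)
  have e1: "exc_discr (a' / r') = (1 - 1 / r'\<^sup>2) / 2" "exc_discr (b' / s') = (1 - 1 / s'\<^sup>2) / 2"
    unfolding defs using exc_discr_fraction pos dv by simp_all
  have den: "3 + a' / r' - b' / s' = m' / (r' * s')"
    using nz m' by (simp add: field_simps)
  have ca: "a' / r' = c' / m' - s' / (r' * m')" using nz rc by (simp add: field_simps)
  have cb: "b' / s' = c' / m' + r' / (s' * m')" using nz sc' by (simp add: field_simps)
  have diff: "(1 - u) / 2 - (1 - v) / 2 = (v - u) / 2" for u v :: rat by (simp add: field_simps)
  have "exc_dot (a' / r') (b' / s') =
      (a' / r' + b' / s') / 2 + ((1 / r'\<^sup>2 - 1 / s'\<^sup>2) / 2) / (m' / (r' * s'))"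
    unfolding exc_dot_def e1 den diff ..
  also have "\<dots> = c' / m'"
    unfolding ca cb using nz by (simp add: field_simps power2_eq_square)
  finally show ?thesis unfolding defs .
qed

lemma eps_double: "eps (2 * p) (Suc q) = eps p q"
  by simp

lemma eps_adj:
  "\<exists>a r b s. adj a r b s \<and> eps p q = of_int a / of_int r \<and> eps (p + 1) q = of_int b / of_int s"
proof (induction q arbitrary: p)
  case 0
  show ?case using adj.base[of p] by (intro exI[of _ p] exI[of _ 1] exI[of _ "p + 1"]) auto
next
  case (Suc q)
  obtain a r b s where A: "adj a r b s" "eps (p div 2) q = of_int a / of_int r"
    "eps (p div 2 + 1) q = of_int b / of_int s"
    using Suc.IH by blast
  obtain m c where M: "m = 3 * r * s - (r * b - s * a)" "r * c = a * m + s"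
    "adj a r c m" "adj c m b s"
    using adj_mediant[OF A(1)] by metis
  have dot: "exc_dot (eps (p div 2) q) (eps (p div 2 + 1) q) = of_int c / of_int m"
    unfolding A using exc_dot_mediant[OF adj_invariant[OF A(1)] M(1,2)] .
  show ?case
  proof (cases "even p")
    case True
    then have "(p + 1) div 2 = p div 2" by presburger
    then have "eps p (Suc q) = of_int a / of_int r" "eps (p + 1) (Suc q) = of_int c / of_int m"
      using True A(2) dot by simp_all
    then show ?thesis using M(3) by blast
  next
    case False
    then have "(p + 1) div 2 = p div 2 + 1" by presburger
    then have "eps p (Suc q) = of_int c / of_int m" "eps (p + 1) (Suc q) = of_int b / of_int s"
      using False A(3) dot by simp_all
    then show ?thesis using M(4) by blast
  qed
qed

text \<open>Converse of \<open>eps_adj\<close>: the rules \<open>left\<close> and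
  \<open>right\<close> pass to the two halves of a dyadic interval, so integer arithmetic on
  \<open>adj\<close> covers precisely the exceptional slopes.\<close>

lemma adj_eps:
  "adj a r b s \<Longrightarrow> \<exists>p q. eps p q = of_int a / of_int r \<and> eps (p + 1) q = of_int b / of_int s"
proof (induction rule: adj.induct)
  case (base n)
  show ?case by (intro exI[of _ n] exI[of _ 0]) simp
next
  case (left a r b s m c)
  obtain p q where e: "eps p q = of_int a / of_int r" "eps (p + 1) q = of_int b / of_int s"
    using left.IH by blast
  have "eps (2 * p) (Suc q) = of_int a / of_int r" using e(1) by simp
  moreover have "eps (2 * p + 1) (Suc q) = exc_dot (eps p q) (eps (p + 1) q)" by simp
  then have "eps (2 * p + 1) (Suc q) = of_int c / of_int m"
    using exc_dot_mediant[OF adj_invariant[OF left.hyps(1)] left.hyps(2,3)] by (simp only: e)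
  ultimately show ?case by blast
next
  case (right a r b s m c)
  obtain p q where e: "eps p q = of_int a / of_int r" "eps (p + 1) q = of_int b / of_int s"
    using right.IH by blast
  note inv = adj_invariant[OF right.hyps(1)]
  have "eps (2 * p + 1) (Suc q) = exc_dot (eps p q) (eps (p + 1) q)" by simp
  then have "eps (2 * p + 1) (Suc q) = of_int c / of_int m"
    using exc_dot_mediant[OF inv right.hyps(2) adj_inv_right(2)[OF inv right.hyps(2,3)]]
    by (simp only: e)
  moreover have "eps (2 * p + 1 + 1) (Suc q) = of_int b / of_int s"
    using e(2) eps_double[of "p + 1" q] by (simp only: distrib_left mult_1_right add.assoc one_add_one)
  ultimately show ?case by blast
qed

section \<open>The intervals around exceptional slopes\<close>

text \<open>This is \<open>x_\<alpha>\<close> in terms of the rank, the smaller root of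
  \<open>y * (3 - y) = 1 / r^2\<close>.\<close>

definition radius :: "int \<Rightarrow> real" where
  "radius r = (3 - sqrt (9 - 4 / (of_int r)\<^sup>2)) / 2"

lemma radius_props:
  assumes "r > 0"
  shows "radius r > 0" "radius r < 1 / 2" "radius r * (3 - radius r) = 1 / (of_int r)\<^sup>2"
    "of_int r * radius r \<le> 1 / 2"
proof -
  define u where "u = 1 / (real_of_int r)\<^sup>2"
  have r1: "real_of_int r \<ge> 1" using assms by simp
  have u: "0 < u" "u \<le> 1" using r1 by (simp_all add: u_def)
  have e: "radius r = (3 - sqrt (9 - 4 * u)) / 2" by (simp add: radius_def u_def)
  have "sqrt (9 - 4 * u) < 3" using u by (simp add: real_less_lsqrt)
  then show pos: "radius r > 0" by (simp add: e)
  have "2 < sqrt (9 - 4 * u)" using u by (intro real_less_rsqrt) simp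
  then show lt: "radius r < 1 / 2" by (simp add: e)
  have "(sqrt (9 - 4 * u))\<^sup>2 = 9 - 4 * u" using u by simp
  then show eq: "radius r * (3 - radius r) = 1 / (of_int r)\<^sup>2"
    unfolding e u_def[symmetric] by (simp add: field_simps power2_eq_square)
  have "of_int r * radius r * 2 \<le> of_int r * radius r * (3 - radius r)"
    using pos lt assms by (intro mult_left_mono) auto
  also have "\<dots> = 1 / of_int r" using eq assms by (simp add: field_simps power2_eq_square)
  also have "\<dots> \<le> 1" using r1 by simp
  finally show "of_int r * radius r \<le> 1 / 2" by simp
qed

lemma exc_radius_fraction:
  assumes "r > 0" "r dvd a\<^sup>2 + 1"
  shows "exc_radius (of_int a / of_int r) = radius r"
proof -
  have "of_rat (exc_discr (of_int a / of_int r)) = (1 - 1 / (real_of_int r)\<^sup>2) / 2"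
    unfolding exc_discr_fraction[OF assms] by (simp add: of_rat_divide of_rat_diff of_rat_power)
  then show ?thesis by (simp add: exc_radius_def radius_def field_simps)
qed

definition exc_fraction :: "int \<Rightarrow> int \<Rightarrow> bool" where
  "exc_fraction a r \<longleftrightarrow> (\<exists>b s. adj a r b s \<or> adj b s a r)"

lemma exc_fraction_mirror: "exc_fraction a r \<Longrightarrow> exc_fraction (- a) r"
  unfolding exc_fraction_def using adj_mirror by blast

lemma exc_fractionD:
  assumes "exc_fraction a r"
  shows "r > 0" "r dvd a\<^sup>2 + 1" "of_int a / of_int r \<in> exceptional_slopes"
proof -
  show "r > 0" "r dvd a\<^sup>2 + 1"
    using assms adj_invariant unfolding exc_fraction_def adj_inv_def by blast+
  show "of_int a / of_int r \<in> exceptional_slopes"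
    using assms adj_eps unfolding exc_fraction_def exceptional_slopes_def by (smt (verit) mem_Collect_eq)
qed

lemma exc_fraction_interval:
  assumes "exc_fraction a r"
  shows "x \<in> exc_interval (of_int a / of_int r) \<longleftrightarrow> \<bar>x - of_int a / of_int r\<bar> < radius r"
  using exc_radius_fraction[OF exc_fractionD(1,2)[OF assms]]
  by (auto simp: exc_interval_def of_rat_divide)

lemma exceptional_slope_fraction:
  assumes "\<alpha> \<in> exceptional_slopes"
  obtains a r where "exc_fraction a r" "\<alpha> = of_int a / of_int r"
  using assms eps_adj unfolding exceptional_slopes_def exc_fraction_def by blast

lemma adj_gap:
  assumes "adj a r b s"
  defines "t \<equiv> of_int b / of_int s - of_int a / of_int r"
  shows "t = of_int (r * b - s * a) / of_int (r * s)" "0 < t" "t \<le> 1"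
    "t * (3 - t) = 1 / (real_of_int r)\<^sup>2 + 1 / (real_of_int s)\<^sup>2"
    "radius r + radius s \<le> t"
proof -
  have pos: "r > 0" "s > 0" and D: "r * b - s * a > 0" "r * b - s * a \<le> r * s"
    and mk: "(r * b - s * a) * (3 * r * s - (r * b - s * a)) = r\<^sup>2 + s\<^sup>2"
    using adj_invariant[OF assms(1)] unfolding adj_inv_def by auto
  define D where "D = real_of_int (r * b - s * a)"
  define r' s' where "r' = real_of_int r" "s' = real_of_int s"
  have nz: "r' > 0" "s' > 0" using pos by (simp_all add: r'_s'_def)
  show t: "t = of_int (r * b - s * a) / of_int (r * s)"
    using pos by (simp add: t_def field_simps)
  then have t': "t = D / (r' * s')" by (simp add: D_def r'_s'_def)
  have "real_of_int (r * b - s * a) > 0" "real_of_int (r * s) > 0"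
    using D(1) pos by (simp_all only: of_int_0_less_iff mult_pos_pos)
  then show t0: "0 < t" unfolding t by (rule divide_pos_pos)
  have "D \<le> r' * s'" unfolding D_def r'_s'_def using D(2) by (metis of_int_le_iff of_int_mult)
  then show t1: "t \<le> 1" using nz by (simp add: t')
  have "D * (3 * r' * s' - D) = r'\<^sup>2 + s'\<^sup>2"
    using arg_cong[OF mk, of real_of_int] by (simp add: D_def r'_s'_def)
  then have "t * (3 - t) = 1 / r'\<^sup>2 + 1 / s'\<^sup>2"
    unfolding t' using nz by (simp add: field_simps power2_eq_square)
  then show e: "t * (3 - t) = 1 / (real_of_int r)\<^sup>2 + 1 / (real_of_int s)\<^sup>2"
    by (simp add: r'_s'_def)
  define u where "u = radius r + radius s"
  note R = radius_props[OF pos(1)] and S = radius_props[OF pos(2)]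
  have "u * (3 - u) = t * (3 - t) - 2 * (radius r * radius s)"
    unfolding e u_def using R(3) S(3) by (simp add: algebra_simps)
  then have le: "u * (3 - u) < t * (3 - t)" using R(1) S(1) by simp
  have "u < 1" using R(2) S(2) by (simp add: u_def)
  show "radius r + radius s \<le> t"
  proof (rule ccontr)
    assume "\<not> ?thesis"
    then have "t < u" by (simp add: u_def)
    then have "(u - t) * (3 - u - t) > 0" using \<open>u < 1\<close> t1 by simp
    then show False using le by (simp add: algebra_simps)
  qed
qed

section \<open>Disjointness of the intervals\<close>

lemma eps_raise: "eps (p * 2 ^ k) (q + k) = eps p q"
  by (induction k) (simp_all add: mult.left_commute)

lemma exc_interval_below:
  assumes "p < p'" "x \<in> exc_interval (eps p q)" "y \<in> exc_interval (eps p' q)"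
  shows "x < y"
proof -
  define L where "L p = of_rat (eps p q) - exc_radius (eps p q)" for p
  define R where "R p = of_rat (eps p q) + exc_radius (eps p q)" for p
  have RL: "R i \<le> L (i + 1)" and LR: "L i \<le> R i" for i
  proof -
    obtain a r b s where A: "adj a r b s" "eps i q = of_int a / of_int r"
      "eps (i + 1) q = of_int b / of_int s"
      using eps_adj by blast
    then have v: "exc_fraction a r" "exc_fraction b s" by (auto simp: exc_fraction_def)
    have e: "exc_radius (eps i q) = radius r" "exc_radius (eps (i + 1) q) = radius s"
      unfolding A using v exc_fractionD exc_radius_fraction by blast+
    show "R i \<le> L (i + 1)"
      using adj_gap(5)[OF A(1)] unfolding R_def L_def e unfolding A by (simp add: of_rat_divide)
    show "L i \<le> R i"
      using radius_props(1)[OF exc_fractionD(1)[OF v(1)]] unfolding R_def L_def e by simp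
  qed
  have "R p \<le> L p'" using assms(1)
  proof (induction p' rule: int_gr_induct)
    case base
    show ?case using RL .
  next
    case (step i)
    then show ?case using RL[of i] LR[of i] by linarith
  qed
  then show ?thesis using assms(2,3) by (simp add: exc_interval_def L_def R_def)
qed

lemma exc_interval_disjoint:
  assumes "\<alpha> \<in> exceptional_slopes" "\<beta> \<in> exceptional_slopes"
    "x \<in> exc_interval \<alpha>" "x \<in> exc_interval \<beta>"
  shows "\<alpha> = \<beta>"
proof -
  obtain p q p' q' where e: "\<alpha> = eps p q" "\<beta> = eps p' q'"
    using assms by (auto simp: exceptional_slopes_def)
  \<comment> \<open>Both dyadic arguments are written over the common denominator
    \<open>2 ^ (q + q')\<close>.\<close>
  define i j where "i = p * 2 ^ q'" "j = p' * 2 ^ q"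
  have e': "\<alpha> = eps i (q + q')" "\<beta> = eps j (q + q')"
    unfolding i_j_def e by (simp_all add: eps_raise add.commute[of q q'])
       (metis eps_raise add.commute)+
  have "\<not> i < j" "\<not> j < i"
    using assms(3,4) exc_interval_below unfolding e' by blast+
  then show ?thesis by (simp add: e')
qed

section \<open>Approximation of points outside all intervals\<close>

text \<open>The inequality is weak because the intervals are open: their end points count as
  outside.\<close>

definition gap_point :: "real \<Rightarrow> bool" where
  "gap_point x \<longleftrightarrow> (\<forall>a r. exc_fraction a r \<longrightarrow> radius r \<le> \<bar>x - of_int a / of_int r\<bar>)"

lemma gap_point_mirror: "gap_point x \<Longrightarrow> gap_point (- x)"
  unfolding gap_point_def
proof (intro allI impI)
  fix a r assume H: "\<forall>a r. exc_fraction a r \<longrightarrow> radius r \<le> \<bar>x - real_of_int a / real_of_int r\<bar>"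
    and "exc_fraction a r"
  then have "radius r \<le> \<bar>x - real_of_int (- a) / real_of_int r\<bar>" using exc_fraction_mirror by blast
  then show "radius r \<le> \<bar>- x - real_of_int a / real_of_int r\<bar>" by simp
qed

lemma not_gap_point:
  assumes "\<not> gap_point x"
  obtains a r where "exc_fraction a r" "x \<in> exc_interval (of_int a / of_int r)"
  using assms exc_fraction_interval unfolding gap_point_def by (metis not_le)

definition straddle :: "real \<Rightarrow> int \<Rightarrow> int \<Rightarrow> int \<Rightarrow> int \<Rightarrow> bool" where
  "straddle x a r b s \<longleftrightarrow> adj a r b s \<and> of_int a / of_int r < x \<and> x < of_int b / of_int s"

text \<open>The error is scaled by the rank, as this is the quantity that integrality
  controls.\<close>

definition approximable :: "real \<Rightarrow> nat \<Rightarrow> bool" where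
  "approximable x N \<longleftrightarrow>
     (\<exists>a r. exc_fraction a r \<and> r \<ge> int N \<and> of_int r * \<bar>x - of_int a / of_int r\<bar> * of_nat N \<le> 1)"

lemma approximable_mirror: "approximable (- x) N \<Longrightarrow> approximable x N"
  unfolding approximable_def
proof (elim exE conjE)
  fix a r assume "exc_fraction a r" "int N \<le> r"
    and "real_of_int r * \<bar>- x - real_of_int a / real_of_int r\<bar> * real N \<le> 1"
  moreover have "\<bar>- x - real_of_int a / real_of_int r\<bar> = \<bar>x - real_of_int (- a) / real_of_int r\<bar>"
    by simp
  ultimately show "\<exists>a r. exc_fraction a r \<and> r \<ge> int N \<and> of_int r * \<bar>x - of_int a / of_int r\<bar> * of_nat N \<le> 1"
    using exc_fraction_mirror by metis
qed

lemma gap_point_exc_fraction: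
  assumes "gap_point x" "exc_fraction a r"
  shows "x \<noteq> of_int a / of_int r"
  using assms radius_props(1)[OF exc_fractionD(1)[OF assms(2)]] unfolding gap_point_def by fastforce

text \<open>A gap point never equals an exceptional slope, so subdivision never stops, and
  \<open>m \<ge> 2 * r * s\<close> at least doubles both old ranks.\<close>

lemma straddle_unbounded:
  assumes "gap_point x"
  shows "\<exists>a r b s. straddle x a r b s \<and> max r s \<ge> int N"
proof (induction N)
  case 0
  define n where "n = \<lfloor>x\<rfloor>"
  have A: "adj n 1 (n + 1) 1" by (rule adj.base)
  then have "exc_fraction n 1" by (auto simp: exc_fraction_def)
  then have "x \<noteq> of_int n" using gap_point_exc_fraction[OF assms] by force
  moreover have "of_int n \<le> x" "x < of_int n + 1" unfolding n_def by linarith+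
  ultimately have "straddle x n 1 (n + 1) 1" using A by (simp add: straddle_def)
  then show ?case by fastforce
next
  case (Suc N)
  then obtain a r b s where S: "straddle x a r b s" "max r s \<ge> int N" by blast
  then have A: "adj a r b s" by (simp add: straddle_def)
  obtain m c where M: "m \<ge> 2 * r * s" "adj a r c m" "adj c m b s" using adj_mediant[OF A] by metis
  have pos: "r \<ge> 1" "s \<ge> 1" using adj_invariant[OF A] by (auto simp: adj_inv_def)
  have "2 * r * 1 \<le> 2 * r * s" "2 * s * 1 \<le> 2 * s * r" using pos by (intro mult_left_mono; simp)+
  moreover have "2 * s * r = 2 * r * s" by simp
  ultimately have "2 * r \<le> m" "2 * s \<le> m" using M(1) by linarith+
  then have m: "m \<ge> int (Suc N)" using S(2) pos by (auto simp: max_def split: if_splits)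
  have "exc_fraction c m" using M(3) by (auto simp: exc_fraction_def)
  then have "x < of_int c / of_int m \<or> of_int c / of_int m < x"
    using gap_point_exc_fraction[OF assms] by fastforce
  then show ?case
  proof
    assume "x < of_int c / of_int m"
    then have "straddle x a r c m" using S M by (simp add: straddle_def)
    then show ?thesis using m by fastforce
  next
    assume "of_int c / of_int m < x"
    then have "straddle x c m b s" using S M by (simp add: straddle_def)
    then show ?thesis using m by fastforce
  qed
qed

text \<open>
  If the left end point has large rank but is not yet a good approximation, then \<open>x\<close> lies to the
  right of the new slope. So the right end point stays fixed, and the estimate for the left one,
  which uses that \<open>x\<close> avoids the interval of the right end point, improves geometrically.
\<close>

lemma approximable_step:
  assumes gap: "gap_point x" and na: "\<not> approximable x N"
    and S: "straddle x a r b s" "r \<ge> int N"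
  obtains c m where "straddle x c m b s" "m \<ge> int N"
    "of_int m * (of_int b / of_int s - of_int c / of_int m - radius s) \<le>
     of_int r * (of_int b / of_int s - of_int a / of_int r - radius s) / 2"
proof -
  have A: "adj a r b s" using S by (simp add: straddle_def)
  obtain m c where M: "m = 3 * r * s - (r * b - s * a)" "r * c = a * m + s" "s * c = b * m - r"
    "m \<ge> 2 * r * s" "adj a r c m" "adj c m b s" using adj_mediant[OF A] by metis
  have pos: "r \<ge> 1" "s \<ge> 1" using adj_invariant[OF A] by (auto simp: adj_inv_def)
  have "2 * r * 1 \<le> 2 * r * s" using pos by (intro mult_left_mono; simp)+
  then have mN: "m \<ge> int N" "m \<ge> 1" using M(4) S(2) pos by linarith+
  define r' s' m' where d: "r' = real_of_int r" "s' = real_of_int s" "m' = real_of_int m"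
  have nz: "r' \<ge> 1" "s' \<ge> 1" "m' \<ge> 1" using pos mN by (simp_all add: d)
  have rc: "r' * of_int c = of_int a * m' + s'" unfolding d by (metis M(2) of_int_add of_int_mult)
  have sc: "s' * of_int c = of_int b * m' - r'" unfolding d by (metis M(3) of_int_diff of_int_mult)
  have m2: "2 * r' * s' \<le> m'" unfolding d using M(4) by (metis of_int_le_iff of_int_mult of_int_numeral)
  define t where "t = of_int b / s' - of_int a / r'"
  have t: "t > 0" "radius r + radius s \<le> t" using adj_gap[OF A] by (simp_all add: t_def d)
  have m': "m' = r' * s' * (3 - t)"
    unfolding t_def using nz by (simp add: d M(1) field_simps)
  have "exc_fraction c m" using M by (auto simp: exc_fraction_def)
  have x: "of_int a / r' < x" "x < of_int b / s'" using S by (simp_all add: straddle_def d)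
  have "\<not> x < of_int c / m'"
  proof
    assume "x < of_int c / m'"
    moreover have "of_int c / m' - of_int a / r' = s' / (r' * m')" using rc nz by (simp add: field_simps)
    ultimately have "\<bar>x - of_int a / r'\<bar> \<le> s' / (r' * m')" using x by linarith
    then have "r' * \<bar>x - of_int a / r'\<bar> \<le> s' / m'" using nz by (simp add: field_simps)
    also have "\<dots> \<le> 1 / (2 * r')" using m2 nz by (simp add: field_simps)
    finally have "r' * \<bar>x - of_int a / r'\<bar> * N \<le> 1 / (2 * r') * N"
      by (intro mult_right_mono) auto
    also have "\<dots> \<le> 1 / (2 * r') * r'" using S(2) nz by (intro mult_left_mono) (simp_all add: d)
    also have "\<dots> \<le> 1" using nz by simp
    finally have "approximable x N"
      using A S(2) unfolding approximable_def exc_fraction_def d by blast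
    then show False using na by simp
  qed
  moreover have "x \<noteq> of_int c / m'" using gap_point_exc_fraction[OF gap \<open>exc_fraction c m\<close>] by (simp add: d)
  ultimately have S': "straddle x c m b s" using M x by (simp add: straddle_def d)
  note R = radius_props[of s]
  have rs: "radius s * (3 - radius s) = 1 / s'\<^sup>2" using R(3) pos by (simp add: d)
  have "of_int b / s' - of_int c / m' = r' / (s' * m')" using sc nz by (simp add: field_simps)
  then have "m' * (of_int b / s' - of_int c / m' - radius s) = r' / s' - m' * radius s"
    using nz by (simp add: field_simps)
  also have "r' / s' = r' * s' * (radius s * (3 - radius s))"
    unfolding rs using nz by (simp add: field_simps power2_eq_square)
  \<comment> \<open>The terms with factor 3 cancel. What remains has the factor
    \<open>s' * radius s \<le> 1/2\<close>, which gives the contraction.\<close>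
  also have "r' * s' * (radius s * (3 - radius s)) - m' * radius s = (s' * radius s) * (r' * (t - radius s))"
    unfolding m' by (simp add: algebra_simps)
  also have "\<dots> \<le> 1 / 2 * (r' * (t - radius s))"
    using R(4) pos t(2) radius_props(1)[of r] nz by (intro mult_right_mono) (simp_all add: d)
  finally show ?thesis using that[OF S' mN(1)] by (simp add: d t_def)
qed

text \<open>\<open>V\<close> bounds the scaled error, since \<open>x\<close> stays at least
  \<open>radius s\<close> below \<open>b/s\<close>. Without a good approximation it could be halved
  indefinitely.\<close>

lemma approximable_left:
  assumes gap: "gap_point x" and S: "straddle x a r b s" "r \<ge> int N"
  shows "approximable x N"
proof (rule ccontr)
  assume na: "\<not> approximable x N"
  define V where "V a r = of_int r * (of_int b / of_int s - of_int a / of_int r - radius s)" for a r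
  have iter: "\<exists>c m. straddle x c m b s \<and> m \<ge> int N \<and> V c m \<le> V a r / 2 ^ k" for k
  proof (induction k)
    case 0
    show ?case using S by auto
  next
    case (Suc k)
    then obtain c m where C: "straddle x c m b s" "m \<ge> int N" "V c m \<le> V a r / 2 ^ k" by blast
    obtain c' m' where "straddle x c' m' b s" "m' \<ge> int N" "V c' m' \<le> V c m / 2"
      using approximable_step[OF gap na C(1,2)] unfolding V_def by metis
    then show ?case using C(3) by (intro exI[of _ c'] exI[of _ m']) auto
  qed
  obtain k where k: "V a r * N < 2 ^ k" using real_arch_pow[of 2 "V a r * N"] by auto
  obtain c m where C: "straddle x c m b s" "m \<ge> int N" "V c m \<le> V a r / 2 ^ k" using iter by blast
  then have A: "adj c m b s" "of_int c / of_int m < x" "x < of_int b / of_int s"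
    by (simp_all add: straddle_def)
  then have v: "exc_fraction b s" "exc_fraction c m" by (auto simp: exc_fraction_def)
  have "radius s \<le> of_int b / of_int s - x" using gap v A unfolding gap_point_def by fastforce
  then have "of_int m * \<bar>x - of_int c / of_int m\<bar> \<le> V c m"
    unfolding V_def using A exc_fractionD(1)[OF v(2)] by (intro mult_left_mono) auto
  also have "\<dots> \<le> V a r / 2 ^ k" by fact
  finally have "of_int m * \<bar>x - of_int c / of_int m\<bar> * N \<le> V a r / 2 ^ k * N"
    by (intro mult_right_mono) auto
  also have "\<dots> \<le> 1" using k by (simp add: field_simps)
  finally show False using na C v unfolding approximable_def by blast
qed

text \<open>Either end point may be the one of large rank; negation reduces the right one to the
  left one.\<close>

lemma gap_point_approximable:
  assumes "gap_point x"
  shows "approximable x N"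
proof -
  obtain a r b s where S: "straddle x a r b s" "max r s \<ge> int N" using straddle_unbounded[OF assms] by blast
  show ?thesis
  proof (cases "r \<ge> int N")
    case True
    then show ?thesis using approximable_left[OF assms S(1)] by blast
  next
    case False
    then have "s \<ge> int N" using S by simp
    moreover have "straddle (- x) (- b) s (- a) r" using S adj_mirror by (simp add: straddle_def)
    ultimately have "approximable (- x) N"
      using approximable_left[OF gap_point_mirror[OF assms]] by blast
    then show ?thesis by (rule approximable_mirror)
  qed
qed

text \<open>Distinct fractions satisfy \<open>r * \<bar>p/q - a/r\<bar> \<ge> 1/q\<close>, which
  \<open>N = q + 1\<close> contradicts.\<close>

lemma rational_not_gap_point:
  assumes "q > 0"
  shows "\<not> gap_point (of_int p / of_int q)"
proof
  assume gap: "gap_point (of_int p / of_int q)"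
  define N where "N = nat q + 1"
  obtain a r where v: "exc_fraction a r"
    and le: "of_int r * \<bar>of_int p / of_int q - of_int a / of_int r\<bar> * of_nat N \<le> (1 :: real)"
    using gap_point_approximable[OF gap, of N] unfolding approximable_def by blast
  have r: "r > 0" using exc_fractionD[OF v] by simp
  have "of_int p / of_int q \<noteq> (of_int a / of_int r :: real)" using gap_point_exc_fraction[OF gap v] .
  then have "real_of_int (p * r) \<noteq> of_int (a * q)" using r assms by (simp add: frac_eq_eq)
  then have "p * r \<noteq> a * q" by metis
  then have "1 \<le> \<bar>p * r - a * q\<bar>" by linarith
  then have "1 \<le> \<bar>real_of_int p * r - a * q\<bar>"
    by (metis of_int_1_le_iff of_int_abs of_int_diff of_int_mult)
  also have "real_of_int p * r - a * q = of_int r * (of_int p / of_int q - of_int a / of_int r) * of_int q"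
    using r assms by (simp add: field_simps)
  finally have one: "1 \<le> of_int r * \<bar>of_int p / of_int q - of_int a / of_int r\<bar> * real_of_int q"
    using r assms by (simp add: abs_mult)
  have "real N = of_int q + 1" using assms by (simp add: N_def)
  then have "of_int r * \<bar>of_int p / of_int q - of_int a / of_int r\<bar> \<le> (0 :: real)"
    using le one by (simp add: algebra_simps)
  then show False using one assms by (smt (verit) mult_nonpos_nonneg of_int_0_less_iff)
qed

section \<open>The orthogonal parabola\<close>

lemma DLP_upper:
  assumes "\<alpha> \<in> exceptional_slopes" "\<bar>\<mu> - of_rat \<alpha>\<bar> < 3"
  shows "P (- \<bar>\<mu> - of_rat \<alpha>\<bar>) - of_rat (exc_discr \<alpha>) \<le> DLP \<mu>"
  unfolding DLP_def
proof (rule cSup_upper)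
  show "bdd_above {P (- \<bar>\<mu> - of_rat \<alpha>\<bar>) - of_rat (exc_discr \<alpha>) |\<alpha>.
      \<alpha> \<in> exceptional_slopes \<and> \<bar>\<mu> - of_rat \<alpha>\<bar> < 3}"
  proof (rule bdd_aboveI[of _ 1], clarify)
    fix \<alpha> assume E: "\<alpha> \<in> exceptional_slopes" and d: "\<bar>\<mu> - of_rat \<alpha>\<bar> < 3"
    define y where "y = \<bar>\<mu> - of_rat \<alpha>\<bar>"
    obtain a r where v: "exc_fraction a r" "\<alpha> = of_int a / of_int r" using E exceptional_slope_fraction by blast
    have "exc_discr \<alpha> \<ge> 0"
      using exc_fractionD(1)[OF v(1)] unfolding v exc_discr_fraction[OF exc_fractionD(1,2)[OF v(1)]] by simp
    \<comment> \<open>\<open>P (- y) = 1 - y * (3 - y) / 2\<close>; the resulting bound makes the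
      real \<open>Sup\<close> meaningful.\<close>
    moreover have "y * (3 - y) \<ge> 0" using d by (simp add: y_def)
    then have "P (- y) \<le> 1" by (simp add: P_def power2_eq_square algebra_simps)
    ultimately show "P (- \<bar>\<mu> - of_rat \<alpha>\<bar>) - of_rat (exc_discr \<alpha>) \<le> 1"
      unfolding y_def by (smt (verit) zero_le_of_rat_iff)
  qed
qed (use assms in auto)

lemma of_rat_exc_discr:
  assumes "exc_fraction a r"
  shows "(of_rat (exc_discr (of_int a / of_int r)) :: real) = (1 - 1 / (of_int r)\<^sup>2) / 2"
  unfolding exc_discr_fraction[OF exc_fractionD(1,2)[OF assms]]
  by (simp add: of_rat_divide of_rat_diff of_rat_power)

text \<open>For the \<open>\<alpha>\<close> whose interval contains the slope, the term of the
  supremum exceeds 1/2 by \<open>(1/r^2 - y * (3 - y)) / 2\<close>, positive because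
  \<open>y < radius r\<close>.\<close>

lemma DLP_gt_half:
  assumes "q > 0"
  shows "DLP (of_int p / of_int q) > 1 / 2"
proof -
  define \<mu> where "\<mu> = (of_int p / of_int q :: real)"
  obtain a r where v: "exc_fraction a r" and i: "\<mu> \<in> exc_interval (of_int a / of_int r)"
    using not_gap_point[OF rational_not_gap_point[OF assms, of p]] unfolding \<mu>_def by metis
  define y where "y = \<bar>\<mu> - of_rat (of_int a / of_int r)\<bar>"
  have y: "y < radius r" "y \<ge> 0" using i exc_fraction_interval[OF v] by (simp_all add: y_def of_rat_divide)
  note R = radius_props[OF exc_fractionD(1)[OF v]]
  have "(radius r - y) * (3 - radius r - y) > 0" using y R by simp
  then have "y * (3 - y) < 1 / (of_int r)\<^sup>2" unfolding R(3)[symmetric] by (simp add: algebra_simps)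
  then have "1 / 2 < P (- y) - of_rat (exc_discr (of_int a / of_int r))"
    unfolding of_rat_exc_discr[OF v] P_def by (simp add: field_simps power2_eq_square)
  also have "\<dots> \<le> DLP \<mu>"
    unfolding y_def using exc_fractionD(3)[OF v] y R by (intro DLP_upper) (auto simp: y_def)
  finally show ?thesis unfolding \<mu>_def .
qed

text \<open>Integrality of \<open>\<chi>(E\<^sub>\<alpha>) = r (P(\<alpha>) - \<Delta>\<^sub>\<alpha>)\<close> for \<open>\<alpha> = a/r\<close>, with denominators cleared.\<close>

lemma exc_fraction_euler_char_even:
  fixes a r :: int
  assumes "r > 0" "r dvd a\<^sup>2 + 1"
  shows "2 * r dvd a\<^sup>2 + 1 + 3 * a * r + r\<^sup>2"
proof -
  obtain k where k: "a\<^sup>2 + 1 = r * k" using assms by blast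
  \<comment> \<open>After factoring out \<open>r\<close> only parity is left. For even
    \<open>r\<close>, \<open>a\<close> is odd and \<open>a^2 + 1\<close> is 2 modulo 4, so
    \<open>k\<close> is odd.\<close>
  have "even (k + 3 * a + r)"
  proof (cases "even r")
    case True
    then have "even (a\<^sup>2 + 1)" using k by simp
    then have "odd a" by simp
    then obtain j where "a = 2 * j + 1" by (auto elim: oddE)
    then have "a\<^sup>2 + 1 = 2 * (2 * (j * j + j) + 1)" by (simp add: power2_eq_square algebra_simps)
    moreover obtain r' where "r = 2 * r'" using True by blast
    ultimately have "r' * k = 2 * (j * j + j) + 1" using k by simp
    then have "odd k" by (metis even_mult_iff dvd_triv_left even_plus_one_iff)
    then show ?thesis using \<open>odd a\<close> True by simp
  next
    case False
    then have "even k \<longleftrightarrow> odd a" using k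
      by (metis even_mult_iff even_plus_one_iff even_power pos2)
    then show ?thesis using False by auto
  qed
  then have "2 * r dvd r * (k + 3 * a + r)" by (simp add: mult.commute)
  moreover have "r * (k + 3 * a + r) = a\<^sup>2 + 1 + 3 * a * r + r\<^sup>2"
    using k by (simp add: algebra_simps power2_eq_square)
  ultimately show ?thesis by simp
qed

lemma orthogonal_slope_not_gap_point:
  fixes \<mu> \<Delta> x :: real and n :: int
  assumes n: "n > 0" and c1: "of_int n * \<mu> \<in> \<int>" and chi: "of_int n * (P \<mu> - \<Delta>) \<in> \<int>"
    and \<Delta>: "\<Delta> > 1 / 2" and x: "P (\<mu> + x) - \<Delta> = 1 / 2" "2 * (\<mu> + x) + 3 > 0"
  shows "\<not> gap_point x"
proof
  assume gap: "gap_point x"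
  define w where "w = 2 * (\<mu> + x) + 3"
  have w2: "w\<^sup>2 = 5 + 8 * \<Delta>" using x(1) unfolding w_def P_def by (simp add: power2_eq_square field_simps)
  have "w > 3" using w2 \<Delta> x(2) by (intro power2_less_imp_less[of 3 w]) (auto simp: w_def)
  \<comment> \<open>This size makes \<open>n * (w + 2) / N\<close>, the final bound for the Euler
    characteristic, less than 1; it also forces \<open>\<bar>d\<bar> \<le> 1/5\<close>.\<close>
  obtain N :: nat where N: "real N > of_int n * (w + 2)" using reals_Archimedean2 by blast
  have n1: "real_of_int n \<ge> 1" using n by simp
  have "1 * 5 < of_int n * (w + 2)"
    using n1 \<open>w > 3\<close> by (intro mult_le_less_imp_less) auto
  then have N5: "real N > 5" using N by linarith
  obtain a r where v: "exc_fraction a r" and rN: "r \<ge> int N"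
    and le: "of_int r * \<bar>x - of_int a / of_int r\<bar> * of_nat N \<le> (1 :: real)"
    using gap_point_approximable[OF gap, of N] unfolding approximable_def by blast
  define r' where "r' = real_of_int r"
  define \<alpha> where "\<alpha> = of_int a / r'"
  define d where "d = x - \<alpha>"
  have r': "r' \<ge> N" using rN by (simp add: r'_def)
  have rpos: "r > 0" "r' > 0" using exc_fractionD(1)[OF v] by (simp_all add: r'_def)
  have dN: "r' * \<bar>d\<bar> \<le> 1 / N" using le N5 by (simp add: d_def \<alpha>_def r'_def field_simps)
  have "1 * \<bar>d\<bar> \<le> r' * \<bar>d\<bar>" using r' N5 by (intro mult_right_mono) auto
  also have "\<dots> \<le> 1 / N" by fact
  also have "\<dots> \<le> 1 / 5" using N5 by (simp add: field_simps)
  finally have d5: "\<bar>d\<bar> \<le> 1 / 5" by simp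
  \<comment> \<open>the Euler characteristic of \<open>\<xi>\<close> tensored with the exceptional bundle of slope \<open>\<alpha>\<close>\<close>
  define X where "X = of_int n * r' * (P (\<mu> + \<alpha>) - \<Delta> - (1 - 1 / r'\<^sup>2) / 2)"
  have "2 * r dvd a\<^sup>2 + 1 + 3 * a * r + r\<^sup>2"
    using exc_fraction_euler_char_even exc_fractionD[OF v] by blast
  then obtain k where "a\<^sup>2 + 1 + 3 * a * r + r\<^sup>2 = 2 * r * k" by blast
  then have "real_of_int (a\<^sup>2 + 1 + 3 * a * r + r\<^sup>2) = real_of_int (2 * r * k)" by presburger
  then have k: "(real_of_int a)\<^sup>2 + 1 + 3 * of_int a * r' + r'\<^sup>2 = 2 * r' * of_int k"
    by (simp add: r'_def)
  have "r' * (P \<alpha> - (1 - 1 / r'\<^sup>2) / 2) * (2 * r') = (real_of_int a)\<^sup>2 + 1 + 3 * of_int a * r' + r'\<^sup>2"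
    unfolding P_def \<alpha>_def using rpos by (simp add: field_simps power2_eq_square)
  then have ka: "r' * (P \<alpha> - (1 - 1 / r'\<^sup>2) / 2) = of_int k"
    unfolding k using rpos by (simp add: mult.commute)
  have Pplus: "P (\<mu> + \<alpha>) = P \<mu> + P \<alpha> + \<mu> * \<alpha> - 1"
    by (simp add: P_def power2_eq_square field_simps)
  \<comment> \<open>Riemann-Roch splits \<open>X\<close> into integers: multiples of the Euler
    characteristics of \<open>\<xi>\<close> and of the exceptional bundle, a product of first Chern
    classes and a product of ranks.\<close>
  have "X = r' * (of_int n * (P \<mu> - \<Delta>)) + of_int n * (r' * (P \<alpha> - (1 - 1 / r'\<^sup>2) / 2))
      + (of_int n * \<mu>) * (r' * \<alpha>) - of_int n * r'"
    unfolding X_def Pplus by (simp add: algebra_simps)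
  also have "r' * \<alpha> = of_int a" using rpos by (simp add: \<alpha>_def)
  finally have "X \<in> \<int>"
    unfolding ka using c1 chi by (auto intro!: Ints_add Ints_diff Ints_mult simp: r'_def)
  have "P (\<mu> + \<alpha>) = P (\<mu> + x) - d * (w - d) / 2"
    by (simp add: P_def d_def w_def power2_eq_square field_simps)
  then have eq: "P (\<mu> + \<alpha>) - \<Delta> - (1 - 1 / r'\<^sup>2) / 2 = (1 / r'\<^sup>2 - d * (w - d)) / 2"
    using x(1) by (simp add: diff_divide_distrib)
  have X: "X = of_int n * (1 / r' - r' * (d * (w - d))) / 2"
    unfolding X_def eq using rpos by (simp add: field_simps power2_eq_square)
  have "\<bar>1 / r' - r' * (d * (w - d))\<bar> \<le> 1 / r' + r' * \<bar>d\<bar> * \<bar>w - d\<bar>"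
    using rpos abs_triangle_ineq4[of "1 / r'" "r' * (d * (w - d))"] by (simp add: abs_mult mult.assoc)
  also have "\<dots> \<le> 1 / N + 1 / N * (w + 1)"
    using dN r' rpos N5 d5 \<open>w > 3\<close>
    by (intro add_mono mult_mono) (auto simp: field_simps)
  also have "\<dots> = (w + 2) / N" using N5 by (simp add: field_simps)
  finally have "of_int n * \<bar>1 / r' - r' * (d * (w - d))\<bar> \<le> of_int n * ((w + 2) / N)"
    using n by (intro mult_left_mono) auto
  also have "\<dots> < 1" using N N5 by (simp add: field_simps)
  finally have "\<bar>X\<bar> < 1" using n unfolding X by (simp add: abs_mult)
  then have "X = 0" using \<open>X \<in> \<int>\<close> by (auto elim!: Ints_cases)
  then have "1 / r' = r' * (d * (w - d))" using n unfolding X by simp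
  then have "d * (w - d) = 1 / r'\<^sup>2" using rpos by (simp add: field_simps power2_eq_square)
  note R = radius_props[OF rpos(1)]
  have dw: "d * (w - d) = radius r * (3 - radius r)"
    unfolding R(3) using \<open>d * (w - d) = 1 / r'\<^sup>2\<close> by (simp add: r'_def)
  moreover have "radius r * (3 - radius r) > 0" using R rpos by simp
  ultimately have "d * (w - d) > 0" by simp
  then have "d > 0" using \<open>w > 3\<close> d5 by (auto simp: zero_less_mult_iff)
  have "radius r \<le> d"
    using gap v \<open>d > 0\<close> unfolding gap_point_def d_def \<alpha>_def r'_def by fastforce
  \<comment> \<open>So \<open>d * (3 - d) \<ge> radius r * (3 - radius r) = d * (w - d)\<close>,
    impossible for \<open>w > 3\<close> and \<open>d > 0\<close>.\<close>
  then have "0 \<le> (d - radius r) * (3 - d - radius r)" using d5 R by (intro mult_nonneg_nonneg) auto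
  moreover have "d * 3 < d * w" using \<open>d > 0\<close> \<open>w > 3\<close> by simp
  ultimately show False using dw by (simp add: algebra_simps)
qed

theorem theorem3p1:
  fixes \<xi> :: chern_character
  assumes "rk \<xi> > 0" and "picard_rank_two \<xi>"
  shows "card (orth_parabola \<xi> \<inter> {(\<mu>, \<Delta>). \<Delta> = 1/2}) = 2 \<and>
    (\<forall>\<mu>\<^sub>0 :: real.
       (\<mu>\<^sub>0, 1/2) \<in> orth_parabola \<xi> \<and> (\<forall>\<mu>. (\<mu>, 1/2) \<in> orth_parabola \<xi> \<longrightarrow> \<mu> \<le> \<mu>\<^sub>0) \<longrightarrow>
       (\<exists>!\<alpha>. \<alpha> \<in> exceptional_slopes \<and> \<mu>\<^sub>0 \<in> exc_interval \<alpha>))"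
proof -
  define n where "n = rk \<xi>"
  define \<mu> where "\<mu> = slope \<xi>"
  define \<Delta> where "\<Delta> = discr \<xi>"
  have n: "n > 0" using assms by (simp add: n_def)
  have c1: "ch1 \<xi> \<in> \<int>" and chi: "of_int n * (P \<mu> - \<Delta>) \<in> \<int>" and DLP: "\<Delta> > DLP \<mu>"
    using assms(2) by (simp_all add: picard_rank_two_def euler_char_def n_def \<mu>_def \<Delta>_def)
  obtain p where p: "ch1 \<xi> = of_int p" using c1 by (auto elim: Ints_cases)
  have \<mu>: "\<mu> = of_int p / of_int n" by (simp add: \<mu>_def slope_def p n_def)
  have \<Delta>: "\<Delta> > 1 / 2" using DLP DLP_gt_half[OF n, of p] unfolding \<mu> by linarith
  define w where "w = sqrt (5 + 8 * \<Delta>)"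
  have w: "w > 0" "w\<^sup>2 = 5 + 8 * \<Delta>" using \<Delta> by (simp_all add: w_def)
  \<comment> \<open>The two solutions of \<open>(2 * (\<mu> + y) + 3)^2 = w^2\<close>.\<close>
  define y1 y2 where y_def: "y1 = (w - 3) / 2 - \<mu>" "y2 = (- w - 3) / 2 - \<mu>"
  have mem: "(y, 1 / 2) \<in> orth_parabola \<xi> \<longleftrightarrow> y = y1 \<or> y = y2" for y
  proof -
    have lin: "2 * (\<mu> + y) + 3 = v \<longleftrightarrow> y = (v - 3) / 2 - \<mu>" for v
      by (simp add: eq_diff_eq eq_divide_eq algebra_simps)
    have sq: "(2 * (\<mu> + y) + 3)\<^sup>2 - w\<^sup>2 = 8 * (P (\<mu> + y) - \<Delta> - 1 / 2)"
      unfolding w(2) P_def by (simp add: power2_eq_square algebra_simps)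
    have "(y, 1 / 2) \<in> orth_parabola \<xi> \<longleftrightarrow> P (\<mu> + y) - \<Delta> - 1 / 2 = 0"
      unfolding orth_parabola_def \<mu>_def \<Delta>_def by auto
    also have "\<dots> \<longleftrightarrow> (2 * (\<mu> + y) + 3)\<^sup>2 = w\<^sup>2"
      unfolding eq_iff_diff_eq_0[of "(2 * (\<mu> + y) + 3)\<^sup>2"] sq by (simp only: mult_eq_0_iff) simp
    also have "\<dots> \<longleftrightarrow> 2 * (\<mu> + y) + 3 = w \<or> 2 * (\<mu> + y) + 3 = - w" by (rule power2_eq_iff)
    finally show ?thesis unfolding lin y_def .
  qed
  have "orth_parabola \<xi> \<inter> {(\<mu>, \<Delta>). \<Delta> = 1 / 2} = {(y1, 1 / 2), (y2, 1 / 2)}"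
    using mem by blast
  moreover have "y1 \<noteq> y2" using w(1) by (simp add: y_def)
  ultimately have card: "card (orth_parabola \<xi> \<inter> {(\<mu>, \<Delta>). \<Delta> = 1 / 2}) = 2" by simp
  have "\<exists>!\<alpha>. \<alpha> \<in> exceptional_slopes \<and> \<mu>\<^sub>0 \<in> exc_interval \<alpha>"
    if H: "(\<mu>\<^sub>0, 1 / 2) \<in> orth_parabola \<xi>" "\<forall>\<mu>. (\<mu>, 1 / 2) \<in> orth_parabola \<xi> \<longrightarrow> \<mu> \<le> \<mu>\<^sub>0" for \<mu>\<^sub>0
  proof -
    \<comment> \<open>Maximality is used only to select the positive square root
      \<open>w\<close>.\<close>
    have "y1 \<le> \<mu>\<^sub>0" using H(2) mem by blast
    moreover have "2 * (\<mu> + y1) + 3 = w" by (simp add: y_def field_simps)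
    ultimately have pos: "2 * (\<mu> + \<mu>\<^sub>0) + 3 > 0" using w(1) by (simp add: distrib_left)
    have "P (\<mu> + \<mu>\<^sub>0) - \<Delta> = 1 / 2" using H(1) by (simp add: orth_parabola_def \<mu>_def \<Delta>_def)
    moreover have "of_int n * \<mu> \<in> \<int>" using n by (simp add: \<mu>)
    ultimately have "\<not> gap_point \<mu>\<^sub>0"
      using orthogonal_slope_not_gap_point[OF n _ chi \<Delta> _ pos] by simp
    then obtain a r where "exc_fraction a r" "\<mu>\<^sub>0 \<in> exc_interval (of_int a / of_int r)"
      by (rule not_gap_point)
    then show ?thesis using exc_fractionD(3) exc_interval_disjoint by blast
  qed
  then show ?thesis using card by blast
qed

end
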